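(* Let $n\ge 5$ and let $k$ be the length of a winning path on the $n\times n$ Hex board. Then: (a) if $n\equiv 0\pmod 4$, then $k\le \frac{n^2}{2}-\frac{n}{4}$; (b) if $n\equiv 1\pmod 4$, then $k\le \frac{n^2}{2}-\frac{n}{4}-\frac14$; (c) if $n\equiv 2\pmod 4$, then $k\le \frac{n^2}{2}-\frac{n}{4}-\frac12$; (d) if $n\equiv 3\pmod 8$, then $k\le \frac{n^2}{2}-\frac{n}{4}-\frac34$; (e) if $n\equiv 7\pmod 8$, then $k\le \frac{n^2}{2}-\frac{n}{4}+\frac14$.
   Context: The $n\times n$ Hex board has cells $(x,y)$ with $x,y\in\{1,\dots,n\}$. Two cells $(x,y),(x',y')$ are adjacent iff $(x'-x,y'-y)\in\{(\pm1,0),(0,\pm1),(1,-1),(-1,1)\}$. Row $1$ is the top edge and row $n$ the bottom edge. A winning connection is a set $S$ of cells containing a subset that is connected under adjacency and meets both row $1$ and row $n$. A winning path is an inclusion-minimal winning connection; its length is its number of cells. *)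

theory Defs
  imports Complex_Main
begin

type_synonym cell = "int \<times> int"

definition hex_board :: "nat \<Rightarrow> cell set" where
  "hex_board n = {1..int n} \<times> {1..int n}"

definition hex_adj :: "cell \<Rightarrow> cell \<Rightarrow> bool" where
  "hex_adj c d \<longleftrightarrow>
     (fst d - fst c, snd d - snd c) \<in> {(1, 0), (-1, 0), (0, 1), (0, -1), (1, -1), (-1, 1)}"

definition hex_connected :: "cell set \<Rightarrow> bool" where
  "hex_connected T \<longleftrightarrow>
     (\<forall>c\<in>T. \<forall>d\<in>T. (c, d) \<in> {(a, b). a \<in> T \<and> b \<in> T \<and> hex_adj a b}\<^sup>*)"

text \<open>The row of a cell \<open>(x, y)\<close> is \<open>y\<close>. Reading it as \<open>x\<close> instead would change nothing of
  substance: swapping the coordinates preserves the board and adjacency.\<close>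

definition hex_row :: "nat \<Rightarrow> nat \<Rightarrow> cell set" where
  "hex_row n i = {c \<in> hex_board n. snd c = int i}"

definition winning_connection :: "nat \<Rightarrow> cell set \<Rightarrow> bool" where
  "winning_connection n S \<longleftrightarrow> S \<subseteq> hex_board n \<and>
     (\<exists>T\<subseteq>S. hex_connected T \<and> T \<inter> hex_row n 1 \<noteq> {} \<and> T \<inter> hex_row n n \<noteq> {})"

definition winning_path :: "nat \<Rightarrow> cell set \<Rightarrow> bool" where
  "winning_path n P \<longleftrightarrow> winning_connection n P \<and> (\<forall>Q. Q \<subset> P \<longrightarrow> \<not> winning_connection n Q)"

end

theory Submission
  imports Defs
begin

text \<open>A winning path \<open>P\<close> of \<open>k\<close> cells is an induced path in the triangular lattice that meets the
  first and the last row in its two ends only. Cut the board along the diagonal \<open>x + y = n + 1\<close>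
  into two triangles. In the part \<open>S\<close> of \<open>P\<close> with \<open>x + y \<le> n + 1\<close> no three cells are mutually
  adjacent, so by inclusion-exclusion the union of \<open>S\<close>, \<open>S + (1, 0)\<close> and \<open>S + (0, 1)\<close> has
  \<open>3|S| - E(S)\<close> elements, where \<open>E(S)\<close> is the number of adjacent pairs. This union lies in the
  triangle \<open>x + y \<le> n + 2\<close>; it has exactly two cells in the first row, its cells on
  \<open>x + y = n + 2\<close> are determined by \<open>P\<close> on the diagonal, and of the remaining cells of the triangle
  it misses at least one, because covering everything near the corner \<open>(1, 1)\<close> would force a cell
  of \<open>P\<close> with three neighbours. The other triangle is the image of this one under the half-turn.
  Adding both counts, with \<open>E(P) = k - 1\<close> and the fact that the diagonal meets \<open>P\<close> in at most
  about \<open>n / 2\<close> segments, gives \<open>4 k + n \<le> 2 n\<^sup>2 + 1\<close>. In case of equality the diagonal alternates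
  between free cells and cells where \<open>P\<close> crosses it; then \<open>E(S)\<close> is known from the degrees, and
  the count for \<open>S\<close> alone is impossible modulo 4 when \<open>n\<close> is 3 modulo 8.\<close>

subsection \<open>Adjacent pairs and translates\<close>

definition shift :: "int \<Rightarrow> int \<Rightarrow> cell set \<Rightarrow> cell set" where
  "shift a b S = (\<lambda>(x, y). (x + a, y + b)) ` S"

definition pairs :: "int \<Rightarrow> int \<Rightarrow> cell set \<Rightarrow> cell set" where
  "pairs a b S = {(x, y). (x, y) \<in> S \<and> (x + a, y + b) \<in> S}"

text \<open>One vector is taken from each opposite pair of the six directions, so every unordered
  adjacent pair is counted once.\<close>

definition edge_count :: "cell set \<Rightarrow> nat" where
  "edge_count S = card (pairs 1 0 S) + card (pairs 0 1 S) + card (pairs 1 (-1) S)"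

text \<open>Written out over the six directions so that local arguments reduce to the membership of
  single cells; \<open>deg_eq_card\<close> identifies it with the number of neighbours.\<close>

definition deg :: "cell set \<Rightarrow> cell \<Rightarrow> nat" where
  "deg S c = (case c of (x, y) \<Rightarrow>
     of_bool ((x + 1, y) \<in> S) + of_bool ((x - 1, y) \<in> S) +
     of_bool ((x, y + 1) \<in> S) + of_bool ((x, y - 1) \<in> S) +
     of_bool ((x + 1, y - 1) \<in> S) + of_bool ((x - 1, y + 1) \<in> S))"

lemma mem_shift [simp]: "(x, y) \<in> shift a b S \<longleftrightarrow> (x - a, y - b) \<in> S"
proof
  assume "(x - a, y - b) \<in> S"
  then show "(x, y) \<in> shift a b S"
    unfolding shift_def by (intro image_eqI[where x = "(x - a, y - b)"]) auto
qed (auto simp: shift_def)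

lemma card_shift [simp]: "card (shift a b S) = card S"
  unfolding shift_def by (rule card_image) (auto simp: inj_on_def)

lemma finite_shift [simp]: "finite S \<Longrightarrow> finite (shift a b S)"
  by (simp add: shift_def)

lemma mem_pairs [simp]: "(x, y) \<in> pairs a b S \<longleftrightarrow> (x, y) \<in> S \<and> (x + a, y + b) \<in> S"
  by (simp add: pairs_def)

lemma pairs_subset: "pairs a b S \<subseteq> S"
  by (auto simp: pairs_def)

lemma finite_pairs [simp]: "finite S \<Longrightarrow> finite (pairs a b S)"
  by (rule finite_subset[OF pairs_subset])

lemma card_pairs_uminus: "card (pairs (- a) (- b) S) = card (pairs a b S)"
proof -
  have "pairs (- a) (- b) S = shift a b (pairs a b S)" by auto
  then show ?thesis by simp
qed

lemma sum_deg:
  assumes "finite S"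
  shows "(\<Sum>c\<in>S. deg S c) = 2 * edge_count S"
proof -
  have *: "(\<Sum>c\<in>S. of_bool ((fst c + a, snd c + b) \<in> S)) = card (pairs a b S)" for a b :: int
  proof -
    have "pairs a b S = {c \<in> S. (fst c + a, snd c + b) \<in> S}" by auto
    then show ?thesis using assms by (simp add: sum.If_cases of_bool_def Int_def)
  qed
  have "deg S c = of_bool ((fst c + 1, snd c + 0) \<in> S) + of_bool ((fst c + (-1), snd c + 0) \<in> S) +
     of_bool ((fst c + 0, snd c + 1) \<in> S) + of_bool ((fst c + 0, snd c + (-1)) \<in> S) +
     of_bool ((fst c + 1, snd c + (-1)) \<in> S) + of_bool ((fst c + (-1), snd c + 1) \<in> S)" for c
    by (simp add: deg_def split: prod.split)
  then have "(\<Sum>c\<in>S. deg S c) = card (pairs 1 0 S) + card (pairs (-1) 0 S) + card (pairs 0 1 S)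
      + card (pairs 0 (-1) S) + card (pairs 1 (-1) S) + card (pairs (-1) 1 S)"
    by (simp only: sum.distrib *)
  then show ?thesis
    using card_pairs_uminus[of 1 0 S] card_pairs_uminus[of 0 1 S] card_pairs_uminus[of 1 "-1" S]
    by (simp add: edge_count_def)
qed

text \<open>Inclusion-exclusion: each pairwise intersection is a translate of the pairs in one
  direction, and a cell (x, y) common to all three sets would give the triangle (x, y), (x - 1, y),
  (x, y - 1) excluded by \<open>tri\<close>.\<close>

lemma card_Un3_shift:
  assumes fin: "finite S"
    and tri: "\<And>x y. (x + 1, y) \<in> S \<Longrightarrow> (x, y + 1) \<in> S \<Longrightarrow> (x + 1, y + 1) \<in> S \<Longrightarrow> False"
  shows "card (S \<union> shift 1 0 S \<union> shift 0 1 S) + edge_count S = 3 * card S"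
proof -
  let ?B = "shift 1 0 S" and ?C = "shift 0 1 S"
  have e: "S \<inter> ?B = shift 1 0 (pairs 1 0 S)" "S \<inter> ?C = shift 0 1 (pairs 0 1 S)"
    "?B \<inter> ?C = shift 1 0 (pairs 1 (-1) S)" by auto
  have t: "(S \<inter> ?C) \<inter> (?B \<inter> ?C) = {}"
  proof -
    have "(x - 1, y) \<in> S \<Longrightarrow> (x, y - 1) \<in> S \<Longrightarrow> (x, y) \<in> S \<Longrightarrow> False" for x y
      using tri[of "x - 1" "y - 1"] by simp
    then show ?thesis by auto
  qed
  have "card (S \<union> ?B) + card (S \<inter> ?B) = card S + card ?B"
    using fin card_Un_Int[of S ?B] by simp
  moreover have "card ((S \<union> ?B) \<union> ?C) + card ((S \<union> ?B) \<inter> ?C) = card (S \<union> ?B) + card ?C"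
    using fin card_Un_Int[of "S \<union> ?B" ?C] by simp
  moreover have "card ((S \<union> ?B) \<inter> ?C) = card (S \<inter> ?C) + card (?B \<inter> ?C)"
    using fin t by (simp add: Int_Un_distrib2 card_Un_disjoint)
  ultimately show ?thesis by (simp add: e edge_count_def)
qed

lemma card_triangle:
  "2 * card {(x, y). 1 \<le> x \<and> 2 \<le> y \<and> x + y \<le> int n + 1} = n * (n - 1)"
proof (induction n)
  case 0
  have "{(x, y). 1 \<le> x \<and> 2 \<le> y \<and> x + y \<le> int 0 + 1} = {}" by auto
  then show ?case by (simp only: card.empty)
next
  case (Suc n)
  let ?T = "\<lambda>n. {(x, y). 1 \<le> x \<and> 2 \<le> y \<and> x + y \<le> int n + 1}"
  let ?L = "(\<lambda>y. (int n + 2 - y, y)) ` {2..int n + 1}"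
  have fin: "finite (?T n)"
    by (rule finite_subset[of _ "{1..int n} \<times> {2..int n + 1}"]) auto
  have "?T (Suc n) = ?T n \<union> ?L" by (auto simp: image_iff)
  moreover have "?T n \<inter> ?L = {}" by auto
  ultimately have "card (?T (Suc n)) = card (?T n) + card ?L"
    using fin by (simp add: card_Un_disjoint)
  moreover have "card ?L = n" by (subst card_image) (auto simp: inj_on_def)
  ultimately show ?case using Suc.IH by (cases n) auto
qed

subsection \<open>The two halves of the board\<close>

definition lower :: "nat \<Rightarrow> cell set \<Rightarrow> cell set" where
  "lower n P = {(x, y). (x, y) \<in> P \<and> x + y \<le> int n + 1}"

definition diag :: "nat \<Rightarrow> cell set \<Rightarrow> cell set" where
  "diag n P = {(x, y). (x, y) \<in> P \<and> x + y = int n + 1}"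

definition rot :: "nat \<Rightarrow> cell set \<Rightarrow> cell set" where
  "rot n S = (\<lambda>(x, y). (int n + 1 - x, int n + 1 - y)) ` S"

lemma mem_rot [simp]: "(x, y) \<in> rot n S \<longleftrightarrow> (int n + 1 - x, int n + 1 - y) \<in> S"
proof
  assume "(int n + 1 - x, int n + 1 - y) \<in> S"
  then show "(x, y) \<in> rot n S"
    unfolding rot_def by (intro image_eqI[where x = "(int n + 1 - x, int n + 1 - y)"]) auto
qed (auto simp: rot_def)

lemma mem_lower [simp]: "(x, y) \<in> lower n P \<longleftrightarrow> (x, y) \<in> P \<and> x + y \<le> int n + 1"
  by (simp add: lower_def)

lemma mem_diag [simp]: "(x, y) \<in> diag n P \<longleftrightarrow> (x, y) \<in> P \<and> x + y = int n + 1"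
  by (simp add: diag_def)

lemma card_rot [simp]: "card (rot n S) = card S"
  unfolding rot_def by (rule card_image) (auto simp: inj_on_def)

lemma card_pairs_rot [simp]: "card (pairs a b (rot n S)) = card (pairs a b S)"
proof -
  have "pairs a b (rot n S) = rot n (pairs (- a) (- b) S)"
    by (auto simp: algebra_simps)
  then show ?thesis by (simp add: card_pairs_uminus)
qed

lemma edge_count_rot [simp]: "edge_count (rot n S) = edge_count S"
  by (simp add: edge_count_def)

lemma diag_rot: "diag n (rot n P) = rot n (diag n P)"
  by auto

subsection \<open>Induced paths between the top and the bottom row\<close>

text \<open>Only local data of an induced path are recorded, in a form stable under the half-turn:
  it exchanges the two end rows and the two orientations of triangles. Each result on one half of
  the board thus holds for the other half too.\<close>

locale hex_snake =
  fixes n :: nat and P :: "cell set"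
  assumes n_ge: "n \<ge> 5"
    and board: "(x, y) \<in> P \<Longrightarrow> 1 \<le> x \<and> x \<le> int n \<and> 1 \<le> y \<and> y \<le> int n"
    and top: "\<exists>!x. (x, 1) \<in> P"
    and bottom: "\<exists>!x. (x, int n) \<in> P"
    and deg_eq: "(x, y) \<in> P \<Longrightarrow> deg P (x, y) = (if y = 1 \<or> y = int n then 1 else 2)"
    and up_triangle: "(x, y) \<in> P \<Longrightarrow> (x + 1, y) \<in> P \<Longrightarrow> (x, y + 1) \<in> P \<Longrightarrow> False"
    and down_triangle: "(x + 1, y) \<in> P \<Longrightarrow> (x, y + 1) \<in> P \<Longrightarrow> (x + 1, y + 1) \<in> P \<Longrightarrow> False"
begin

section \<open>Edges of the path and the count in one triangle\<close>

lemma finite_P: "finite P"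
proof -
  have "P \<subseteq> {1..int n} \<times> {1..int n}" using board by auto
  then show ?thesis using finite_subset by blast
qed

text \<open>Handshake: the two ends, distinct because they lie in different rows, have degree 1 and
  all other cells have degree 2.\<close>

lemma edge_count_P: "edge_count P + 1 = card P"
proof -
  obtain i where i: "\<And>x. (x, 1) \<in> P \<longleftrightarrow> x = i" using top by metis
  obtain j where j: "\<And>x. (x, int n) \<in> P \<longleftrightarrow> x = j" using bottom by metis
  let ?E = "{(i, 1), (j, int n)}"
  have sub: "?E \<subseteq> P" using i j by auto
  have cE: "card ?E = 2" using n_ge by simp
  have dE: "(\<Sum>c\<in>?E. deg P c) = (\<Sum>c\<in>?E. 1)"
    by (rule sum.cong[OF refl]) (use sub deg_eq in auto)
  have dR: "(\<Sum>c\<in>P - ?E. deg P c) = (\<Sum>c\<in>P - ?E. 2)"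
  proof (rule sum.cong[OF refl])
    fix c assume c: "c \<in> P - ?E"
    obtain x y where "c = (x, y)" by fastforce
    with c i j show "deg P c = 2" using deg_eq[of x y] by auto
  qed
  have "(\<Sum>c\<in>P. deg P c) = 2 * card (P - ?E) + 2"
    using sum.subset_diff[OF sub finite_P, of "deg P"] cE by (simp only: dE dR) simp
  moreover have "card (P - ?E) + 2 = card P"
    using card_Diff_subset[of ?E P] card_mono[OF finite_P sub] cE sub by simp
  ultimately show ?thesis using sum_deg[OF finite_P] by simp
qed

text \<open>If no cell were missed, \<open>P\<close> would be forced cell by cell near (1, 1): first
  (1, 2), then the top end in column 1 or 2. Whether or not (2, 2) is in \<open>P\<close>, the cell
  (2, 3) finally gets three neighbours.\<close>

lemma corner:
  "\<exists>x y. 1 \<le> x \<and> 2 \<le> y \<and> x + y \<le> int n + 1 \<and> (x, y) \<notin> P \<and> (x - 1, y) \<notin> P \<and> (x, y - 1) \<notin> P"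
proof (rule ccontr)
  assume "\<not> ?thesis"
  then have cov: "(x, y) \<in> P \<or> (x - 1, y) \<in> P \<or> (x, y - 1) \<in> P"
    if "1 \<le> x" "2 \<le> y" "x + y \<le> int n + 1" for x y
    using that by blast
  obtain i where i: "\<And>x. (x, 1) \<in> P \<longleftrightarrow> x = i" using top by metis
  have i1: "1 \<le> i" using board i by blast
  have left: "(0, y) \<notin> P" for y using board by force
  have d2: "deg P (x, y) = 2" if "(x, y) \<in> P" "y \<noteq> 1" "y \<noteq> int n" for x y
    using deg_eq that by simp
  have n5: "5 \<le> int n" using n_ge by simp
  \<comment> \<open>The two neighbours of an inner cell are not adjacent to each other, which leaves one choice here
    and in the next step.\<close>
  have row2: "(x - 1, 3) \<in> P"
    if "(x, 2) \<in> P" "(x - 1, 2) \<notin> P" "i \<noteq> x" "i \<noteq> x + 1" for x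
    using d2[of x 2] that up_triangle[of x 2] down_triangle[of "x - 1" 2] i n5
    by (auto simp: deg_def of_bool_def split: if_splits)
  have col1: "(2, y - 1) \<in> P"
    if "(1, y) \<in> P" "(1, y - 1) \<notin> P" "2 \<le> y" for y
  proof (cases "y = int n")
    case True
    have "(2, int n) \<notin> P" using bottom that True by force
    moreover have "(1, int n + 1) \<notin> P" using board by force
    ultimately show ?thesis using deg_eq[of 1 y] that True left
      by (auto simp: deg_def of_bool_def split: if_splits)
  next
    case False
    then show ?thesis
    using d2[of 1 y] that up_triangle[of 1 y] down_triangle[of 1 "y - 1"] left
    by (auto simp: deg_def of_bool_def split: if_splits)
  qed
  have P12: "(1, 2) \<in> P"
  proof (cases "i = 1")
    case True
    have "(2, 0) \<notin> P" "(1, 0) \<notin> P" using board by force+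
    then show ?thesis using deg_eq[of 1 1] True left i
      by (auto simp: deg_def of_bool_def split: if_splits)
  next
    case False
    then show ?thesis using cov[of 1 2] left i n5 by auto
  qed
  \<comment> \<open>Otherwise the two neighbours of (1, 2) in \<open>P\<close> would be (2, 2) and
    (1, 3), which are adjacent.\<close>
  have i2: "i \<le> 2"
    using d2[of 1 2] P12 left up_triangle[of 1 2] n5 i i1
    by (auto simp: deg_def of_bool_def split: if_splits)
  show False
  proof (cases "(2, 2) \<in> P")
    case True
    have "i \<noteq> 2" using down_triangle[of 1 1] True P12 i by auto
    then have "i = 1" using i1 i2 by linarith
    note i = i[unfolded this]
    have "(1, 3) \<notin> P" using up_triangle[of 1 2] True P12 by auto
    then have P14: "(1, 4) \<in> P" using cov[of 1 4] left n5 by auto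
    then have P23: "(2, 3) \<in> P" using col1[of 4] \<open>(1, 3) \<notin> P\<close> by auto
    have "(3, 2) \<notin> P"
      using d2[of 2 2] True P12 P23 n5 by (auto simp: deg_def)
    then have "(4, 2) \<in> P" using cov[of 4 2] i n5 by auto
    then have "(3, 3) \<in> P" using row2[of 4] \<open>(3, 2) \<notin> P\<close> \<open>i = 1\<close> by auto
    then show False using d2[of 2 3] True P23 P14 n5 by (auto simp: deg_def)
  next
    case False
    have P13: "(1, 3) \<in> P"
      using d2[of 1 2] P12 left False n5 i
      by (auto simp: deg_def of_bool_def split: if_splits)
    have P32: "(3, 2) \<in> P" using cov[of 3 2] False i i2 n5 by auto
    then have P23: "(2, 3) \<in> P" using row2[of 3] False i2 by auto
    have "(1, 4) \<notin> P" using d2[of 1 3] P13 P12 P23 n5 by (auto simp: deg_def)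
    \<comment> \<open>This cell belongs to the triangle since n is at least 5. For n = 5 it lies in
      the last row, hence the separate case \<open>y = int n\<close> in \<open>col1\<close>.\<close>
    then have "(1, 5) \<in> P" using cov[of 1 5] left n5 by auto
    then have "(2, 4) \<in> P" using col1[of 5] \<open>(1, 4) \<notin> P\<close> by auto
    then show False using d2[of 2 3] P13 P32 P23 n5 by (auto simp: deg_def)
  qed
qed

lemma finite_parts [simp]: "finite (lower n P)" "finite (diag n P)"
  by (rule finite_subset[OF _ finite_P]; auto)+

text \<open>Here \<open>m\<close> is the number of cells of the triangle below its first row that
  the three copies of \<open>lower n P\<close> miss. The union has two cells in the first row, and
  on x + y = n + 2 it consists of the translates of the diagonal cells. These two parts overlap only
  in (n + 1, 1), when the top end is (n, 1). All terms are doubled to avoid halving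
  \<open>n * (n - 1)\<close>.\<close>

lemma lower_count:
  obtains m where "m \<ge> 1"
    and "6 * card (lower n P) + 2 * m + 2 * of_bool ((int n, 1) \<in> P) + 2 * card (pairs 1 (-1) (diag n P))
       = 4 + 4 * card (diag n P) + n * (n - 1) + 2 * edge_count (lower n P)"
proof
  let ?S = "lower n P" and ?A = "diag n P"
  let ?U = "?S \<union> shift 1 0 ?S \<union> shift 0 1 ?S"
  let ?T = "{(x, y). 1 \<le> x \<and> 2 \<le> y \<and> x + y \<le> int n + 1}"
  define M where "M = {(x, y) \<in> ?T. (x, y) \<notin> P \<and> (x - 1, y) \<notin> P \<and> (x, y - 1) \<notin> P}"
  have fT: "finite ?T"
    by (rule finite_subset[of _ "{1..int n} \<times> {2..int n + 1}"]) auto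
  have MT: "M \<subseteq> ?T" by (auto simp: M_def)
  then have fM: "finite M" using fT finite_subset by blast
  have "M \<noteq> {}" using corner by (auto simp: M_def)
  then show "card M \<ge> 1" using fM by (simp add: Suc_le_eq card_gt_0_iff)
  obtain i where i: "\<And>x. (x, 1) \<in> P \<longleftrightarrow> x = i" using top by metis
  have i_le: "1 \<le> i" "i \<le> int n" using board i by blast+
  let ?R = "{(i, 1), (i + 1, 1)}" and ?D = "shift 1 0 ?A \<union> shift 0 1 ?A"
  have U: "?U = (?R \<union> ?D) \<union> (?T - M)"
  proof (rule set_eqI)
    fix c :: cell obtain x y where c: "c = (x, y)" by fastforce
    have b: "1 \<le> a \<and> a \<le> int n \<and> 1 \<le> b \<and> b \<le> int n" if "(a, b) \<in> P" for a b
      using board that .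
    consider "y \<le> 0" | "y = 1" | "y \<ge> 2" "x \<le> 0" | "y \<ge> 2" "x \<ge> 1" by linarith
    then show "c \<in> ?U \<longleftrightarrow> c \<in> (?R \<union> ?D) \<union> (?T - M)"
    proof cases
      case 1
      then show ?thesis using b[of x y] b[of "x - 1" y] b[of x "y - 1"] by (auto simp: c M_def)
    next
      case 2
      moreover have "(x, 0) \<notin> P" using b[of x 0] by auto
      ultimately show ?thesis using i_le by (auto simp: c M_def i)
    next
      case 3
      then show ?thesis using b[of x y] b[of "x - 1" y] b[of x "y - 1"] by (auto simp: c M_def)
    next
      case 4
      then show ?thesis using b[of x y] b[of "x - 1" y] b[of x "y - 1"] by (auto simp: c M_def)
    qed
  qed
  have "card ?U = card (?R \<union> ?D) + card (?T - M)"
    unfolding U by (rule card_Un_disjoint) (use fT i_le in auto)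
  moreover have "card (?T - M) + card M = card ?T"
    using card_Diff_subset[OF fM MT] card_mono[OF fT MT] by simp
  moreover have "card (?R \<union> ?D) + card (?R \<inter> ?D) = 2 + card ?D"
    using card_Un_Int[of ?R ?D] by simp
  moreover have "card (?R \<inter> ?D) = of_bool ((int n, 1) \<in> P)"
  proof -
    have "?R \<inter> ?D = (if i = int n then {(int n + 1, 1)} else {})"
      using i i_le board[of _ 0] by auto
    then show ?thesis using i by auto
  qed
  moreover have "card ?D + card (pairs 1 (-1) ?A) = 2 * card ?A"
  proof -
    have "shift 1 0 ?A \<inter> shift 0 1 ?A = shift 1 0 (pairs 1 (-1) ?A)" by auto
    then show ?thesis using card_Un_Int[of "shift 1 0 ?A" "shift 0 1 ?A"] by simp
  qed
  moreover have "card ?U + edge_count ?S = 3 * card ?S"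
    by (rule card_Un3_shift) (use down_triangle in auto)
  moreover have "2 * card ?T = n * (n - 1)" by (rule card_triangle)
  ultimately show "6 * card ?S + 2 * card M + 2 * of_bool ((int n, 1) \<in> P) + 2 * card (pairs 1 (-1) ?A)
       = 4 + 4 * card ?A + n * (n - 1) + 2 * edge_count ?S"
    by linarith
qed

section \<open>The half-turn, and gluing the two triangles along the diagonal\<close>

lemma hex_snake_rot: "hex_snake n (rot n P)"
proof
  show "n \<ge> 5" by (rule n_ge)
  show "1 \<le> x \<and> x \<le> int n \<and> 1 \<le> y \<and> y \<le> int n" if "(x, y) \<in> rot n P" for x y
    using board[of "int n + 1 - x" "int n + 1 - y"] that by auto
  obtain i where i: "\<And>x. (x, 1) \<in> P \<longleftrightarrow> x = i" using top by metis
  obtain j where j: "\<And>x. (x, int n) \<in> P \<longleftrightarrow> x = j" using bottom by metis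
  show "\<exists>!x. (x, 1) \<in> rot n P" by (rule ex1I[of _ "int n + 1 - j"]) (auto simp: j)
  show "\<exists>!x. (x, int n) \<in> rot n P" by (rule ex1I[of _ "int n + 1 - i"]) (auto simp: i)
  show "deg (rot n P) (x, y) = (if y = 1 \<or> y = int n then 1 else 2)" if "(x, y) \<in> rot n P" for x y
    using deg_eq[of "int n + 1 - x" "int n + 1 - y"] that by (auto simp: deg_def algebra_simps)
  show False if "(x, y) \<in> rot n P" "(x + 1, y) \<in> rot n P" "(x, y + 1) \<in> rot n P" for x y
    using down_triangle[of "int n - x" "int n - y"] that by (simp add: algebra_simps)
  show False if "(x + 1, y) \<in> rot n P" "(x, y + 1) \<in> rot n P" "(x + 1, y + 1) \<in> rot n P" for x y
    using up_triangle[of "int n - x" "int n - y"] that by (simp add: algebra_simps)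
qed

text \<open>Turned back, the second half is the part of \<open>P\<close> with x + y \<ge> n + 1, so
  exactly the diagonal is counted twice.\<close>

lemma card_halves: "card (lower n P) + card (lower n (rot n P)) = card P + card (diag n P)"
proof -
  let ?V = "rot n (lower n (rot n P))"
  have "lower n P \<union> ?V = P" "lower n P \<inter> ?V = diag n P" by auto
  moreover have "finite ?V" by (rule finite_subset[OF _ finite_P]) auto
  ultimately show ?thesis using card_Un_Int[of "lower n P" ?V] by simp
qed

text \<open>Along an edge x + y changes by at most 1, so each edge lies in one of the halves; it
  lies in both only if it runs along the diagonal, in direction (1, -1).\<close>

lemma edge_count_halves:
  "edge_count (lower n P) + edge_count (lower n (rot n P))
     = edge_count P + card (pairs 1 (-1) (diag n P))"
proof -
  let ?S = "lower n P"
  define V where "V = rot n (lower n (rot n P))"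
  have V: "(x, y) \<in> V \<longleftrightarrow> (x, y) \<in> P \<and> x + y \<ge> int n + 1" for x y
    by (auto simp: V_def)
  have fV: "finite V" by (rule finite_subset[OF _ finite_P]) (auto simp: V)
  have eV: "edge_count (lower n (rot n P)) = edge_count V" by (simp add: V_def)
  have *: "card (pairs a b ?S) + card (pairs a b V) = card (pairs a b P) + card C"
    if "pairs a b ?S \<union> pairs a b V = pairs a b P" "pairs a b ?S \<inter> pairs a b V = C" for a b C
    using card_Un_Int[of "pairs a b ?S" "pairs a b V"] fV that by simp
  have "card (pairs 1 0 ?S) + card (pairs 1 0 V) = card (pairs 1 0 P) + card ({} :: cell set)"
    by (rule *) (auto simp: V)
  moreover have "card (pairs 0 1 ?S) + card (pairs 0 1 V) = card (pairs 0 1 P) + card ({} :: cell set)"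
    by (rule *) (auto simp: V)
  moreover have "card (pairs 1 (-1) ?S) + card (pairs 1 (-1) V)
      = card (pairs 1 (-1) P) + card (pairs 1 (-1) (diag n P))"
    by (rule *) (auto simp: V)
  ultimately show ?thesis
    unfolding eV by (simp add: edge_count_def)
qed

text \<open>Cells minus pairs on the diagonal is the number of maximal runs of \<open>P\<close>
  there. A run ending strictly between the corners has a free cell after its last cell; these blocks
  of two are disjoint in columns 2 to n, so there are at most (n - 1) / 2 of them. Runs ending in a
  corner are paid for by the \<open>of_bool\<close> terms. In the case of equality the blocks tile
  columns 2 to n.\<close>

lemma diag_segments:
  "2 * card (diag n P) \<le> 2 * card (pairs 1 (-1) (diag n P)) + (n - 1)
     + 2 * of_bool ((int n, 1) \<in> P) + 2 * of_bool ((1, int n) \<in> P)" (is ?le)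
  and diag_segments_eq:
  "2 * card (diag n P) = 2 * card (pairs 1 (-1) (diag n P)) + (n - 1)
     + 2 * of_bool ((int n, 1) \<in> P) + 2 * of_bool ((1, int n) \<in> P) \<Longrightarrow>
   pairs 1 (-1) (diag n P) = {} \<and> (int n, 1) \<notin> P \<and> (1, int n) \<notin> P"
proof -
  define w where "w x \<longleftrightarrow> (x, int n + 1 - x) \<in> P" for x
  \<comment> \<open>\<open>?D\<close> holds the columns where a run ends; \<open>?Q\<close> is its
    part away from the corners and \<open>?E\<close> the rest.\<close>
  let ?A = "diag n P" and ?Q = "{x \<in> {2..int n - 1}. w x \<and> \<not> w (x + 1)}"
  let ?E = "(if w 1 \<and> \<not> w 2 then {1} else {}) \<union> (if w (int n) then {int n} else {})"
  let ?D = "{x \<in> {1..int n}. w x \<and> \<not> w (x + 1)}"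
  have w_bound: "1 \<le> x \<and> x \<le> int n" if "w x" for x
    using board that unfolding w_def by blast
  have wn: "w (int n) \<longleftrightarrow> (int n, 1) \<in> P" and w1: "w 1 \<longleftrightarrow> (1, int n) \<in> P"
    by (simp_all add: w_def)
  have "?A - pairs 1 (-1) ?A = (\<lambda>x. (x, int n + 1 - x)) ` ?D"
  proof (rule set_eqI)
    fix c :: cell obtain x y where c: "c = (x, y)" by fastforce
    show "c \<in> ?A - pairs 1 (-1) ?A \<longleftrightarrow> c \<in> (\<lambda>x. (x, int n + 1 - x)) ` ?D"
    proof (cases "y = int n + 1 - x")
      case True
      have "w x \<longleftrightarrow> (x, y) \<in> P" by (simp add: w_def True)
      moreover have "w (x + 1) \<longleftrightarrow> (x + 1, y - 1) \<in> P" by (simp add: w_def True)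
      ultimately show ?thesis using w_bound[of x] True by (auto simp: c image_iff)
    qed (auto simp: c)
  qed
  moreover have "inj_on (\<lambda>x. (x, int n + 1 - x)) ?D" by (auto simp: inj_on_def)
  ultimately have "card (?A - pairs 1 (-1) ?A) = card ?D" by (simp add: card_image)
  then have D: "card ?A = card (pairs 1 (-1) ?A) + card ?D"
    using card_Diff_subset[of "pairs 1 (-1) ?A" ?A] card_mono[of ?A "pairs 1 (-1) ?A"]
    by (simp add: pairs_subset)
  have "?D = ?Q \<union> ?E"
  proof (rule set_eqI)
    fix x
    consider "x \<le> 0" | "x = 1" | "2 \<le> x" "x < int n" | "x = int n" | "x > int n" by linarith
    then show "x \<in> ?D \<longleftrightarrow> x \<in> ?Q \<union> ?E"
      using w_bound[of "int n + 1"] n_ge by cases (auto split: if_splits)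
  qed
  moreover have "card ?E \<le> of_bool (w 1 \<and> \<not> w 2) + of_bool (w (int n))"
    by (rule order_trans[OF card_Un_le]) auto
  ultimately have D_le: "card ?D \<le> card ?Q + (of_bool (w 1 \<and> \<not> w 2) + of_bool (w (int n)))"
    using card_Un_le[of ?Q ?E] by simp
  let ?Q' = "(\<lambda>x. x + 1) ` ?Q"
  have fQ: "finite ?Q" by (rule finite_subset[of _ "{2..int n - 1}"]) auto
  have QQ: "card (?Q \<union> ?Q') = 2 * card ?Q"
  proof -
    have "?Q \<inter> ?Q' = {}" by auto
    moreover have "card ?Q' = card ?Q" by (rule card_image) (auto simp: inj_on_def)
    ultimately show ?thesis using fQ by (simp add: card_Un_disjoint)
  qed
  have sub: "?Q \<union> ?Q' \<subseteq> {2..int n}" by auto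
  have Q_le: "2 * card ?Q \<le> n - 1"
    using card_mono[OF _ sub] QQ by simp
  show ?le using D D_le Q_le by (auto simp: wn w1 of_bool_def split: if_splits)
  assume eq: "2 * card ?A = 2 * card (pairs 1 (-1) ?A) + (n - 1)
     + 2 * of_bool ((int n, 1) \<in> P) + 2 * of_bool ((1, int n) \<in> P)"
  \<comment> \<open>Equality leaves no slack: if \<open>w 1\<close> and \<open>w 2\<close> both
    held, the corner (1, n) would be paid for without ending a run.\<close>
  have "2 * card ?Q = n - 1" and w12: "w 1 \<Longrightarrow> \<not> w 2"
    using eq D D_le Q_le by (auto simp: wn w1 of_bool_def split: if_splits)
  then have "?Q \<union> ?Q' = {2..int n}"
    using card_subset_eq[OF _ sub] QQ by simp
  then have cov: "x \<in> ?Q \<or> x - 1 \<in> ?Q" if "2 \<le> x" "x \<le> int n" for x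
  proof -
    have "x \<in> ?Q \<union> ?Q'" using that \<open>?Q \<union> ?Q' = {2..int n}\<close> by auto
    then show ?thesis by auto
  qed
  \<comment> \<open>Columns 1 and n are not in \<open>?Q\<close>, so the tiling starts with the
    block at 2 and ends with the block at n - 1, whose second column n is free.\<close>
  have "w 2" using cov[of 2] n_ge by auto
  have no_pair: "\<not> w (x + 1)" if "w x" for x
  proof
    assume x1: "w (x + 1)"
    show False
    proof (cases "x = 1")
      case True
      then show False using w12 that x1 by simp
    next
      case False
      then show False using w_bound[OF that] w_bound[OF x1] cov[of x] that x1 by simp
    qed
  qed
  have "pairs 1 (-1) ?A = {}"
  proof -
    have "(x + 1, y - 1) \<notin> P" if "(x, y) \<in> P" "x + y = int n + 1" for x y
    proof -
      have y: "y = int n + 1 - x" using that by linarith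
      show ?thesis using no_pair[of x] that(1) by (simp add: w_def y)
    qed
    then show ?thesis by auto
  qed
  moreover have "\<not> w (int n)" using cov[of "int n"] n_ge by auto
  moreover have "\<not> w 1" using w12 \<open>w 2\<close> by blast
  ultimately show "pairs 1 (-1) ?A = {} \<and> (int n, 1) \<notin> P \<and> (1, int n) \<notin> P"
    using wn w1 by blast
qed

text \<open>Handshake within the half: the top end and every diagonal cell have degree 1, and the
  remaining cells keep both neighbours.\<close>

lemma edge_count_lower:
  assumes np: "pairs 1 (-1) (diag n P) = {}"
    and corners: "(int n, 1) \<notin> P" "(1, int n) \<notin> P"
  shows "2 * edge_count (lower n P) + card (diag n P) + 1 = 2 * card (lower n P)"
proof -
  let ?S = "lower n P" and ?A = "diag n P"
  obtain i where i: "\<And>x. (x, 1) \<in> P \<longleftrightarrow> x = i" using top by metis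
  have i_le: "1 \<le> i" "i < int n" using board[of i 1] i corners by (auto simp: order.strict_iff_order)
  let ?O = "insert (i, 1) ?A"
  have no_pair: "(x + 1, y - 1) \<notin> P" if "(x, y) \<in> P" "x + y = int n + 1" for x y
  proof -
    have "(x, y) \<notin> pairs 1 (-1) ?A" unfolding np by blast
    then show ?thesis using that by simp
  qed
  \<comment> \<open>The two neighbours lie off the diagonal, and two on the same side would form a
    triangle with (x, y). Hence \<open>P\<close> crosses the diagonal here.\<close>
  have degA: "deg ?S (x, y) = 1" if "(x, y) \<in> ?A" for x y
  proof -
    have a: "(x, y) \<in> P" "x + y = int n + 1" using that by auto
    then have "(x + 1, y - 1) \<notin> P" "(x - 1, y + 1) \<notin> P"
      using no_pair[of x y] no_pair[of "x - 1" "y + 1"] by auto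
    moreover have "y \<noteq> 1" "y \<noteq> int n" using a corners by auto
    ultimately show ?thesis
      using a deg_eq[of x y] up_triangle[of x y] down_triangle[of "x - 1" "y - 1"]
      by (auto simp: deg_def of_bool_def split: if_splits)
  qed
  have degO: "deg ?S c = 1" if "c \<in> ?O" for c
  proof (cases "c \<in> ?A")
    case True
    then show ?thesis using degA by (cases c) auto
  next
    case False
    then have "c = (i, 1)" using that by auto
    then show ?thesis using deg_eq[of i 1] i i_le by (auto simp: deg_def of_bool_def split: if_splits)
  qed
  have degI: "deg ?S c = 2" if "c \<in> ?S - ?O" for c
  proof -
    obtain x y where c: "c = (x, y)" by fastforce
    then have "(x, y) \<in> P" "x + y \<le> int n" "y \<noteq> 1" using that i by force+
    moreover have "y \<noteq> int n" using calculation board[of x y] by auto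
    ultimately show ?thesis using deg_eq[of x y] by (simp add: c deg_def)
  qed
  have sub: "?O \<subseteq> ?S" using i i_le by auto
  have cO: "card ?O = card ?A + 1" using i_le by auto
  have "(\<Sum>c\<in>?S. deg ?S c) = (\<Sum>c\<in>?S - ?O. 2) + (\<Sum>c\<in>?O. 1)"
    using sum.subset_diff[OF sub, of "deg ?S"] degI degO by simp
  moreover have "card (?S - ?O) + card ?O = card ?S"
    using card_Diff_subset[OF _ sub] card_mono[OF _ sub] by simp
  ultimately show ?thesis using sum_deg[of ?S] cO by simp
qed

text \<open>Adding \<open>lower_count\<close> for \<open>P\<close> and for \<open>rot n P\<close>
  and inserting \<open>diag_segments\<close> cancels the corner terms and \<open>?g\<close>. What
  remains is \<open>4 * card P + n + 2 * (m + m')\<close> \<le> \<open>2 * n\<^sup>2 + 5\<close>,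
  where \<open>m\<close> and \<open>m'\<close> are at least 1.\<close>

lemma card_bound: "4 * card P + n \<le> 2 * n\<^sup>2 + 1"
  and card_bound_strict: "n mod 8 = 3 \<Longrightarrow> 4 * card P + n \<noteq> 2 * n\<^sup>2 + 1"
proof -
  interpret r: hex_snake n "rot n P" by (rule hex_snake_rot)
  let ?N = "card (diag n P)" and ?g = "card (pairs 1 (-1) (diag n P))"
  obtain m where m: "m \<ge> 1" "6 * card (lower n P) + 2 * m + 2 * of_bool ((int n, 1) \<in> P) + 2 * ?g
       = 4 + 4 * ?N + n * (n - 1) + 2 * edge_count (lower n P)"
    by (rule lower_count)
  obtain m' where m': "m' \<ge> 1" "6 * card (lower n (rot n P)) + 2 * m' + 2 * of_bool ((1, int n) \<in> P) + 2 * ?g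
       = 4 + 4 * ?N + n * (n - 1) + 2 * edge_count (lower n (rot n P))"
    by (rule r.lower_count) (auto simp: diag_rot)
  have sq: "n * (n - 1) + n = n\<^sup>2" using n_ge by (cases n) (auto simp: power2_eq_square)
  note facts = m m' card_halves edge_count_halves edge_count_P diag_segments sq n_ge
  show "4 * card P + n \<le> 2 * n\<^sup>2 + 1" using facts by linarith
  assume n8: "n mod 8 = 3"
  show "4 * card P + n \<noteq> 2 * n\<^sup>2 + 1"
  proof
    assume eq: "4 * card P + n = 2 * n\<^sup>2 + 1"
    \<comment> \<open>Equality in the bound makes every estimate used for it an equality.\<close>
    have "m = 1" using facts eq by linarith
    have N: "2 * ?N = 2 * ?g + (n - 1)
     + 2 * of_bool ((int n, 1) \<in> P) + 2 * of_bool ((1, int n) \<in> P)" using facts eq by linarith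
    note d = diag_segments_eq[OF N]
    \<comment> \<open>With the edges eliminated by \<open>edge_count_lower\<close>, n = 8q + 3 and
      \<open>?N\<close> = (n - 1) / 2 make the right-hand side congruent to 2 modulo 4.\<close>
    have "4 * card (lower n P) = 1 + 3 * ?N + n * (n - 1)"
      using m edge_count_lower d \<open>m = 1\<close> by simp
    moreover obtain q where q: "n = 8 * q + 3" using n8 by (metis mult_div_mod_eq)
    moreover have "?N = 4 * q + 1" using N d q by simp
    ultimately have "4 * card (lower n P) = 4 * (16 * q * q + 13 * q + 2) + 2"
      by (simp add: algebra_simps)
    then show False by presburger
  qed
qed

end

subsection \<open>Winning paths are induced paths\<close>

lemma hex_adj_sym: "hex_adj c d \<Longrightarrow> hex_adj d c"
proof -
  let ?F = "{(1, 0), (-1, 0), (0, 1), (0, -1), (1, -1), (-1, 1)} :: cell set"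
  have "(- a, - b) \<in> ?F" if "(a, b) \<in> ?F" for a b
    using that by auto
  from this[of "fst d - fst c" "snd d - snd c"] show "hex_adj c d \<Longrightarrow> hex_adj d c"
    by (simp only: hex_adj_def minus_diff_eq)
qed

lemma hex_adj_iff:
  "hex_adj (x, y) d \<longleftrightarrow> d \<in> {(x + 1, y), (x - 1, y), (x, y + 1), (x, y - 1), (x + 1, y - 1), (x - 1, y + 1)}"
proof -
  have "(fst d - x, snd d - y) = (a, b) \<longleftrightarrow> d = (x + a, y + b)" for a b
    by (cases d) auto
  then show ?thesis
    by (simp only: hex_adj_def fst_conv snd_conv insert_iff empty_iff) simp
qed

lemma deg_eq_card: "finite P \<Longrightarrow> deg P c = card {d \<in> P. hex_adj c d}"
proof -
  obtain x y where c: "c = (x, y)" by fastforce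
  let ?F = "{(x + 1, y), (x - 1, y), (x, y + 1), (x, y - 1), (x + 1, y - 1), (x - 1, y + 1)}"
  have "{d \<in> P. hex_adj c d} = ?F \<inter> P" unfolding c hex_adj_iff by blast
  moreover have "card (?F \<inter> P) = (\<Sum>d\<in>?F. of_bool (d \<in> P))"
    by (subst sum_of_bool_eq) auto
  moreover have "(\<Sum>d\<in>?F. of_bool (d \<in> P)) = deg P c"
    by (simp add: c deg_def)
  ultimately show ?thesis by simp
qed

section \<open>Walks, shortcuts and shortest walks\<close>

lemma rtrancl_hex_walk:
  assumes "(a, b) \<in> {(a, b). a \<in> T \<and> b \<in> T \<and> hex_adj a b}\<^sup>*" "a \<in> T"
  obtains p :: "nat \<Rightarrow> cell" and m where "p 0 = a" "p m = b" "\<forall>i\<le>m. p i \<in> T" "\<forall>i<m. hex_adj (p i) (p (Suc i))"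
proof -
  obtain m where "(a, b) \<in> {(a, b). a \<in> T \<and> b \<in> T \<and> hex_adj a b} ^^ m"
    using assms(1) rtrancl_power by blast
  then obtain p where p: "p 0 = a" "p m = b" "\<forall>i<m. (p i, p (Suc i)) \<in> {(a, b). a \<in> T \<and> b \<in> T \<and> hex_adj a b}"
    unfolding relpow_fun_conv by blast
  have "p i \<in> T" if "i \<le> m" for i
    using that p assms(2) by (cases i) auto
  with p that show thesis by auto
qed

definition hex_walk :: "nat \<Rightarrow> cell set \<Rightarrow> (nat \<Rightarrow> cell) \<Rightarrow> nat \<Rightarrow> bool" where
  "hex_walk n P p m \<longleftrightarrow> p 0 \<in> hex_row n 1 \<and> p m \<in> hex_row n n \<and>
     (\<forall>i\<le>m. p i \<in> P) \<and> (\<forall>i<m. hex_adj (p i) (p (Suc i)))"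

lemma hex_walk_connected:
  assumes "\<forall>i<m. hex_adj (p i) (p (Suc i))"
  shows "hex_connected (p ` {..m})"
proof -
  let ?R = "{(a, b). a \<in> p ` {..m} \<and> b \<in> p ` {..m} \<and> hex_adj a b}"
  have up: "i \<le> j \<Longrightarrow> j \<le> m \<Longrightarrow> (p i, p j) \<in> ?R\<^sup>*" for i j
  proof (induction rule: dec_induct)
    case (step j)
    then have "(p j, p (Suc j)) \<in> ?R" using assms step by auto
    then show ?case using step by (meson Suc_leD rtrancl.rtrancl_into_rtrancl)
  qed auto
  have "sym ?R" by (auto simp: sym_def intro: hex_adj_sym)
  then have "sym (?R\<^sup>*)" by (rule sym_rtrancl)
  then have "(p i, p j) \<in> ?R\<^sup>*" if "i \<le> m" "j \<le> m" for i j
    using up[of i j] up[of j i] that by (meson linear symD)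
  then show ?thesis unfolding hex_connected_def by auto
qed

text \<open>Jumping from index \<open>i\<close> straight to \<open>j\<close> saves
  \<open>j - i - 1\<close> steps, so in a shortest walk only consecutive cells can be
  adjacent.\<close>

lemma hex_walk_shortcut:
  assumes w: "hex_walk n P p m" and ij: "i < j" "j \<le> m" and adj: "hex_adj (p i) (p j)"
  shows "hex_walk n P (\<lambda>t. if t \<le> i then p t else p (t + j - Suc i)) (m + Suc i - j)"
proof -
  let ?q = "\<lambda>t. if t \<le> i then p t else p (t + j - Suc i)"
  have "hex_adj (?q t) (?q (Suc t))" if "t < m + Suc i - j" for t
  proof -
    consider "t < i" | "t = i" | "t > i" by linarith
    then show ?thesis
    proof cases
      case 3
      then have "Suc t + j - Suc i = Suc (t + j - Suc i)" "t + j - Suc i < m" using that ij by auto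
      then show ?thesis using 3 w by (auto simp: hex_walk_def)
    qed (use w ij adj in \<open>auto simp: hex_walk_def\<close>)
  qed
  moreover have "?q t \<in> P" if "t \<le> m + Suc i - j" for t
    using w ij that by (auto simp: hex_walk_def)
  moreover have "?q (m + Suc i - j) = p m" using ij by auto
  moreover have "?q 0 = p 0" by simp
  ultimately show ?thesis using w by (auto simp: hex_walk_def)
qed

text \<open>A shortest walk inside \<open>P\<close> already visits a winning connection, hence all
  of \<open>P\<close> by minimality. Being shortest, it has no chords and meets the end rows only at
  its ends. A repeated cell \<open>p i = p j\<close> with \<open>i < j\<close> would give the chord
  from \<open>i\<close> to \<open>Suc j\<close>, or an early arrival in the last row if
  \<open>j = m\<close>.\<close>

lemma winning_path_walk:
  assumes "winning_path n P"
  obtains p m where "P = p ` {..m}" and "inj_on p {..m}"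
    and "\<forall>i\<le>m. \<forall>j\<le>m. hex_adj (p i) (p j) \<longleftrightarrow> j = Suc i \<or> i = Suc j"
    and "\<forall>i\<le>m. p i \<in> hex_row n 1 \<longleftrightarrow> i = 0"
    and "\<forall>i\<le>m. p i \<in> hex_row n n \<longleftrightarrow> i = m"
proof -
  obtain T where T: "T \<subseteq> P" "hex_connected T" "T \<inter> hex_row n 1 \<noteq> {}" "T \<inter> hex_row n n \<noteq> {}"
    and PB: "P \<subseteq> hex_board n"
    using assms by (auto simp: winning_path_def winning_connection_def)
  obtain a b where ab: "a \<in> T" "a \<in> hex_row n 1" "b \<in> T" "b \<in> hex_row n n" using T by blast
  then have "(a, b) \<in> {(a, b). a \<in> T \<and> b \<in> T \<and> hex_adj a b}\<^sup>*"
    using T(2) by (auto simp: hex_connected_def)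
  then obtain q l where "q 0 = a" "q l = b" "\<forall>i\<le>l. q i \<in> T" "\<forall>i<l. hex_adj (q i) (q (Suc i))"
    using ab(1) by (rule rtrancl_hex_walk)
  then have "hex_walk n P q l" using T(1) ab by (auto simp: hex_walk_def)
  define m where "m = (LEAST m. \<exists>p. hex_walk n P p m)"
  have "\<exists>p. hex_walk n P p m" unfolding m_def by (rule LeastI_ex) (use \<open>hex_walk n P q l\<close> in blast)
  then obtain p where p: "hex_walk n P p m" by blast
  have min: "m \<le> l" if "hex_walk n P q l" for q l
    unfolding m_def by (rule Least_le) (use that in blast)
  have sub: "p ` {..m} \<subseteq> P" using p by (auto simp: hex_walk_def)
  have adj: "hex_adj (p i) (p (Suc i))" if "i < m" for i using p that by (auto simp: hex_walk_def)
  have "winning_connection n (p ` {..m})"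
    unfolding winning_connection_def
  proof (intro conjI exI[of _ "p ` {..m}"])
    show "p ` {..m} \<subseteq> hex_board n" using sub PB by blast
    show "hex_connected (p ` {..m})" using p hex_walk_connected by (auto simp: hex_walk_def)
    show "p ` {..m} \<inter> hex_row n 1 \<noteq> {}" "p ` {..m} \<inter> hex_row n n \<noteq> {}"
      using p by (auto simp: hex_walk_def)
  qed simp
  then have P: "P = p ` {..m}" using assms sub by (auto simp: winning_path_def)
  have chord: "j = Suc i" if "i < j" "j \<le> m" "hex_adj (p i) (p j)" for i j
    using min[OF hex_walk_shortcut[OF p that]] that by linarith
  have start: "i = 0" if "i \<le> m" "p i \<in> hex_row n 1" for i
  proof -
    have "hex_walk n P (\<lambda>t. p (t + i)) (m - i)"
      using p that by (auto simp: hex_walk_def)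
    then show ?thesis using min that by fastforce
  qed
  have stop: "i = m" if "i \<le> m" "p i \<in> hex_row n n" for i
  proof -
    have "hex_walk n P p i" using p that by (auto simp: hex_walk_def)
    then show ?thesis using min that by fastforce
  qed
  have inj: "p i \<noteq> p j" if "i < j" "j \<le> m" for i j
  proof
    assume e: "p i = p j"
    show False
    proof (cases "j = m")
      case True
      then show ?thesis using stop[of i] p e that by (auto simp: hex_walk_def)
    next
      case False
      then have "hex_adj (p i) (p (Suc j))" using adj[of j] e that by simp
      then show ?thesis using chord[of i "Suc j"] that False by auto
    qed
  qed
  show thesis
  proof (rule that[OF P]; (intro allI impI)?)
    show "inj_on p {..m}"
      using inj by (intro inj_onI) (metis atMost_iff linorder_neqE_nat)
    show "hex_adj (p i) (p j) \<longleftrightarrow> j = Suc i \<or> i = Suc j" if "i \<le> m" "j \<le> m" for i j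
    proof
      assume a: "hex_adj (p i) (p j)"
      consider "i < j" | "j < i" | "i = j" by linarith
      then show "j = Suc i \<or> i = Suc j"
      proof cases
        case 3
        then show ?thesis using a by (simp add: hex_adj_def)
      qed (use chord a that hex_adj_sym in blast)+
    next
      assume "j = Suc i \<or> i = Suc j"
      then show "hex_adj (p i) (p j)"
        using adj[of i] adj[of j] hex_adj_sym that by (metis Suc_le_eq)
    qed
    show "p i \<in> hex_row n 1 \<longleftrightarrow> i = 0" if "i \<le> m" for i
      using start p that by (auto simp: hex_walk_def)
    show "p i \<in> hex_row n n \<longleftrightarrow> i = m" if "i \<le> m" for i
      using stop p that by (auto simp: hex_walk_def)
  qed
qed

lemma winning_path_snake:
  assumes n: "n \<ge> 5" and wp: "winning_path n P"
  shows "hex_snake n P"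
proof -
  obtain p m where P: "P = p ` {..m}" and inj: "inj_on p {..m}"
    and adj: "\<forall>i\<le>m. \<forall>j\<le>m. hex_adj (p i) (p j) \<longleftrightarrow> j = Suc i \<or> i = Suc j"
    and start: "\<forall>i\<le>m. p i \<in> hex_row n 1 \<longleftrightarrow> i = 0"
    and stop: "\<forall>i\<le>m. p i \<in> hex_row n n \<longleftrightarrow> i = m"
    using winning_path_walk[OF wp] by blast
  have PB: "P \<subseteq> hex_board n" using wp by (auto simp: winning_path_def winning_connection_def)
  have row: "c \<in> hex_row n r \<longleftrightarrow> snd c = int r" if "c \<in> P" for c r
    using that PB by (auto simp: hex_row_def)
  have s0: "snd (p i) = 1 \<longleftrightarrow> i = 0" if "i \<le> m" for i
    using start row[of "p i" 1] that P by auto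
  have sm: "snd (p i) = int n \<longleftrightarrow> i = m" if "i \<le> m" for i
    using stop row[of "p i" n] that P by auto
  have m: "m \<noteq> 0" using s0[of 0] sm[of 0] n by auto
  \<comment> \<open>Three indices cannot differ pairwise by exactly 1.\<close>
  have tri: False if abc: "a \<in> P" "b \<in> P" "c \<in> P" and adjs: "hex_adj a b" "hex_adj b c" "hex_adj a c" for a b c
  proof -
    obtain i j l where "i \<le> m" "j \<le> m" "l \<le> m" "a = p i" "b = p j" "c = p l"
      using abc unfolding P by blast
    then show False using adjs adj by auto
  qed
  have degP: "deg P (p i) = (if i = 0 \<or> i = m then 1 else 2)" if i: "i \<le> m" for i
  proof -
    let ?J = "{j. j \<le> m \<and> (j = Suc i \<or> i = Suc j)}"
    have "{d \<in> P. hex_adj (p i) d} = p ` ?J" using adj i by (auto simp: P)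
    moreover have "inj_on p ?J" using inj by (rule inj_on_subset) auto
    moreover have "?J = (if i = 0 then {1} else if i = m then {m - 1} else {i - 1, i + 1})"
      using i m by auto
    ultimately show ?thesis using m by (auto simp: deg_eq_card P card_image)
  qed
  show ?thesis
  proof
    show "n \<ge> 5" by (rule n)
    show "1 \<le> x \<and> x \<le> int n \<and> 1 \<le> y \<and> y \<le> int n" if "(x, y) \<in> P" for x y
      using that PB by (auto simp: hex_board_def)
    have *: "\<exists>!x. (x, y) \<in> P" if "t \<le> m" "\<And>i. i \<le> m \<Longrightarrow> snd (p i) = y \<longleftrightarrow> i = t" for y t
    proof (rule ex1I[of _ "fst (p t)"])
      have "(fst (p t), y) = p t" using that by (metis prod.collapse)
      then show "(fst (p t), y) \<in> P" using P that by auto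
      show "x = fst (p t)" if "(x, y) \<in> P" for x
        using that P \<open>\<And>i. i \<le> m \<Longrightarrow> snd (p i) = y \<longleftrightarrow> i = t\<close>
        by (metis atMost_iff fst_conv imageE snd_conv)
    qed
    show "\<exists>!x. (x, 1) \<in> P" using *[of 0 1] s0 by simp
    show "\<exists>!x. (x, int n) \<in> P" using *[of m "int n"] sm by simp
    show "deg P (x, y) = (if y = 1 \<or> y = int n then 1 else 2)" if xy: "(x, y) \<in> P" for x y
    proof -
      obtain i where i: "i \<le> m" "(x, y) = p i" using xy unfolding P by blast
      then have "snd (p i) = y" by (metis snd_conv)
      then show ?thesis using degP[OF i(1)] s0[OF i(1)] sm[OF i(1)] i(2) by simp
    qed
    show False if "(x, y) \<in> P" "(x + 1, y) \<in> P" "(x, y + 1) \<in> P" for x y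
      by (rule tri[OF that]) (simp_all add: hex_adj_def)
    show False if "(x + 1, y) \<in> P" "(x, y + 1) \<in> P" "(x + 1, y + 1) \<in> P" for x y
      by (rule tri[OF that]) (simp_all add: hex_adj_def)
  qed
qed

section \<open>Rounding the bound in each residue class\<close>

theorem theorem4:
  fixes n k :: nat and P :: "cell set"
  assumes "n \<ge> 5"
    and "winning_path n P"
    and "k = card P"
  shows
    "(n mod 4 = 0 \<longrightarrow> real k \<le> (real n)^2 / 2 - real n / 4) \<and>
     (n mod 4 = 1 \<longrightarrow> real k \<le> (real n)^2 / 2 - real n / 4 - 1 / 4) \<and>
     (n mod 4 = 2 \<longrightarrow> real k \<le> (real n)^2 / 2 - real n / 4 - 1 / 2) \<and>
     (n mod 8 = 3 \<longrightarrow> real k \<le> (real n)^2 / 2 - real n / 4 - 3 / 4) \<and>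
     (n mod 8 = 7 \<longrightarrow> real k \<le> (real n)^2 / 2 - real n / 4 + 1 / 4)"
proof -
  interpret hex_snake n P using assms by (intro winning_path_snake)
  have le: "4 * k + n \<le> 2 * n\<^sup>2 + 1"
    and strict: "n mod 8 = 3 \<Longrightarrow> 4 * k + n \<noteq> 2 * n\<^sup>2 + 1"
    using card_bound card_bound_strict assms by auto
  \<comment> \<open>\<open>r\<close> is the slack in \<open>le\<close>. Modulo 4 it is forced to be
    at least 1, 2, 3 for n congruent to 0, 1, 2. For n congruent to 3 it is a multiple of 4, and
    \<open>strict\<close> excludes 0 when n is 3 modulo 8; for 7 modulo 8 the bound is used with
    \<open>r = 0\<close>.\<close>
  have real_le: "real k \<le> (real n)\<^sup>2 / 2 - real n / 4 + (1 - real r) / 4"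
    if "4 * k + n + r \<le> 2 * n\<^sup>2 + 1" for r
  proof -
    have "real (4 * k + n + r) \<le> real (2 * n\<^sup>2 + 1)" using that of_nat_le_iff by blast
    then show ?thesis by (simp add: field_simps)
  qed
  have "2 * (4 * q + r)\<^sup>2 = 4 * (8 * q\<^sup>2 + 4 * q * r) + 2 * r\<^sup>2" for q r :: nat
    by (simp add: power2_eq_square algebra_simps)
  from this[of "n div 4" "n mod 4"] obtain t where t: "2 * n\<^sup>2 = 4 * t + 2 * (n mod 4)\<^sup>2"
    unfolding mult_div_mod_eq by blast
  have c0: "4 * k + n + 1 \<le> 2 * n\<^sup>2 + 1" if "n mod 4 = 0"
  proof -
    have "2 * n\<^sup>2 = 4 * t + 0" using t that by simp
    then show ?thesis using le that by presburger
  qed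
  have c1: "4 * k + n + 2 \<le> 2 * n\<^sup>2 + 1" if "n mod 4 = 1"
  proof -
    have "2 * n\<^sup>2 = 4 * t + 2" using t that by simp
    then show ?thesis using le that by presburger
  qed
  have c2: "4 * k + n + 3 \<le> 2 * n\<^sup>2 + 1" if "n mod 4 = 2"
  proof -
    have "2 * n\<^sup>2 = 4 * t + 8" using t that by simp
    then show ?thesis using le that by presburger
  qed
  have c3: "4 * k + n + 4 \<le> 2 * n\<^sup>2 + 1" if "n mod 8 = 3"
  proof -
    have r: "n mod 4 = 3" using that by presburger
    then have "2 * n\<^sup>2 = 4 * t + 18" using t by simp
    then show ?thesis using le strict[OF that] r by presburger
  qed
  show ?thesis
    using real_le[of 1] real_le[of 2] real_le[of 3] real_le[of 4] real_le[of 0] c0 c1 c2 c3 le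
    by simp
qed

end
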